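(* Let $G$ be a cactus graph with $\operatorname{rad}(G)=2$ and $\operatorname{diam}(G)=2$. Then $G$ is $\chi_\rho$-critical if and only if $G\cong C_5$.
   Context: All graphs are finite and simple. $\operatorname{rad}(G)$ and $\operatorname{diam}(G)$ are the minimum and maximum eccentricity of a vertex of $G$. A cactus graph is a connected graph in which every block is either a cycle or a $K_2$. $C_n$ is the cycle on $n$ vertices. For a positive integer $i$, an $i$-packing in $G$ is a set $X\subseteq V(G)$ with $d_G(x,y)>i$ for all distinct $x,y\in X$. The packing chromatic number $\chi_\rho(G)$ is the smallest positive integer $k$ such that $V(G)$ has a partition $X_1,\dots,X_k$ with $X_i$ an $i$-packing in $G$ for every $i\in\{1,\dots,k\}$ (vertices in different components are at infinite distance; classes may be empty). $G$ is $\chi_\rho$-critical if $\chi_\rho(H)<\chi_\rho(G)$ for every proper subgraph $H$ of $G$. *)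

theory Defs
  imports "Graph_Theory.Graph_Theory" "HOL-Library.Disjoint_Sets"
begin

text \<open>
  Finite simple graphs are the locale \<open>graph\<close> of the Graph Theory library: finite symmetric
  digraphs without loops and parallel arcs, an edge being a pair of opposite arcs. A subgraph of
  such a graph need not be symmetric in the sense of \<open>subgraph\<close>, so \<open>graph H\<close> is
  required wherever an undirected subgraph is meant.
\<close>

text \<open>
  With unit weights the library's shortest-path cost is the number of edges of a shortest walk, and
  \<open>\<infinity>\<close> between different components.
\<close>
definition graph_dist :: "('a, 'b) pre_digraph \<Rightarrow> 'a \<Rightarrow> 'a \<Rightarrow> ereal" where
  "graph_dist G u v = wf_digraph.\<mu> G (\<lambda>_. 1) u v"

definition eccentricity :: "('a, 'b) pre_digraph \<Rightarrow> 'a \<Rightarrow> ereal" where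
  "eccentricity G v = Max (graph_dist G v ` verts G)"

definition radius :: "('a, 'b) pre_digraph \<Rightarrow> ereal" where
  "radius G = Min (eccentricity G ` verts G)"

definition diameter :: "('a, 'b) pre_digraph \<Rightarrow> ereal" where
  "diameter G = Max (eccentricity G ` verts G)"

text \<open>Meaningful for \<open>n \<ge> 3\<close> only.\<close>
definition cycle_graph :: "nat \<Rightarrow> nat pair_pre_digraph" where
  "cycle_graph n =
    \<lparr> pverts = {..<n},
      parcs = {(i, j). i < n \<and> j < n \<and> (j = (i + 1) mod n \<or> i = (j + 1) mod n)} \<rparr>"

text \<open>A cut vertex separates two other vertices of the component it lies in.\<close>
definition cut_vertex :: "('a, 'b) pre_digraph \<Rightarrow> 'a \<Rightarrow> bool" where
  "cut_vertex G v \<longleftrightarrow> v \<in> verts G \<and>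
    (\<exists>x \<in> verts G - {v}. \<exists>y \<in> verts G - {v}.
      x \<rightarrow>\<^sup>*\<^bsub>G\<^esub> y \<and> \<not> x \<rightarrow>\<^sup>*\<^bsub>pre_digraph.del_vert G v\<^esub> y)"

text \<open>
  A block is a maximal connected subgraph without a cut vertex (of the subgraph itself). The name
  \<open>connected\<close> is qualified because of the topological notion.
\<close>
definition is_block :: "('a, 'b) pre_digraph \<Rightarrow> ('a, 'b) pre_digraph \<Rightarrow> bool" where
  "is_block G B \<longleftrightarrow> pre_digraph.max_subgraph G
    (\<lambda>H. graph H \<and> Digraph_Component.connected H \<and> (\<forall>v. \<not> cut_vertex H v)) B"

definition cactus_graph :: "('a, 'b) pre_digraph \<Rightarrow> bool" where
  "cactus_graph G \<longleftrightarrow> graph G \<and> Digraph_Component.connected G \<and>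
    (\<forall>B. is_block G B \<longrightarrow>
      (\<exists>n\<ge>3. digraph_iso B (with_proj (cycle_graph n))) \<or> complete_digraph 2 B)"

definition is_packing :: "('a, 'b) pre_digraph \<Rightarrow> nat \<Rightarrow> 'a set \<Rightarrow> bool" where
  "is_packing G i X \<longleftrightarrow> X \<subseteq> verts G \<and>
    (\<forall>x \<in> X. \<forall>y \<in> X. x \<noteq> y \<longrightarrow> graph_dist G x y > ereal (real i))"

definition packing_colourable :: "('a, 'b) pre_digraph \<Rightarrow> nat \<Rightarrow> bool" where
  "packing_colourable G k \<longleftrightarrow>
    (\<exists>X :: nat \<Rightarrow> 'a set. (\<Union>i\<in>{1..k}. X i) = verts G \<and> disjoint_family_on X {1..k} \<and>
      (\<forall>i\<in>{1..k}. is_packing G i (X i)))"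

definition packing_chromatic_number :: "('a, 'b) pre_digraph \<Rightarrow> nat" where
  "packing_chromatic_number G = (LEAST k. k \<ge> 1 \<and> packing_colourable G k)"

definition packing_critical :: "('a, 'b) pre_digraph \<Rightarrow> bool" where
  "packing_critical G \<longleftrightarrow>
    (\<forall>H. graph H \<and> subgraph H G \<and> H \<noteq> G \<longrightarrow>
      packing_chromatic_number H < packing_chromatic_number G)"

end

theory Submission
  imports Defs
begin

text \<open>
  Radius and diameter two leave very few cactus graphs. If \<open>v\<close> were a cut vertex, a shortest path
  between vertices on different sides of \<open>v\<close> would run through \<open>v\<close>; as it has length at most two,
  every other vertex would be adjacent to \<open>v\<close>, and the radius would be at most one
  (\<open>cut_vertex_universal_if_diameter_le_2\<close>). Hence \<open>G\<close> has no cut vertex, is its own only block, and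
  so is a cycle or an edge. An edge and a triangle have radius one, and a cycle of length six or more
  contains vertices at distance three. What remains is \<open>C\<^sub>4\<close> and \<open>C\<^sub>5\<close>
  (\<open>cactus_radius_2_diameter_2_cycle\<close>).

  The cycle \<open>C\<^sub>4\<close> is 3-colourable, and deleting an edge leaves the path \<open>P\<^sub>4\<close>, which still
  needs three colours; so \<open>C\<^sub>4\<close> is not critical (\<open>cycle_4_not_critical\<close>). In \<open>C\<^sub>5\<close> colour 1 is used
  at most twice, because an independent set has at most two vertices, and every other colour at most
  once, because no two vertices are more than two apart; five vertices therefore need four colours.
  A proper subgraph misses some edge, so it is contained in a path \<open>P\<^sub>5\<close>; colouring the
  path \<open>1, 2, 1, 3, 1\<close> shows that three colours suffice for it (\<open>cycle_5_critical\<close>).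
\<close>

section \<open>Small distances\<close>

lemma graph_dist_le_iff_walk:
  assumes "wf_digraph G"
  shows "graph_dist G u v \<le> ereal (real n) \<longleftrightarrow> (\<exists>p. pre_digraph.awalk G u p v \<and> length p \<le> n)"
proof -
  interpret wf_digraph G by fact
  have cost: "awalk_cost (\<lambda>_. 1) p = real (length p)" for p :: "'b list"
    by (induct p) auto
  have dist: "graph_dist G u v = (INF p\<in>{p. awalk u p v}. ereal (real (length p)))"
    by (simp add: graph_dist_def \<mu>_def cost)
  show ?thesis
  proof
    assume le: "graph_dist G u v \<le> ereal (real n)"
    show "\<exists>p. awalk u p v \<and> length p \<le> n"
    proof (rule ccontr)
      assume "\<not> ?thesis"
      then have "ereal (real (Suc n)) \<le> graph_dist G u v"
        unfolding dist by (intro INF_greatest) (auto simp: not_le Suc_le_eq)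
      then have "ereal (real (Suc n)) \<le> ereal (real n)" using le by (rule order_trans)
      then show False by simp
    qed
  next
    assume "\<exists>p. awalk u p v \<and> length p \<le> n"
    then show "graph_dist G u v \<le> ereal (real n)"
      unfolding dist by (auto intro: INF_lower2)
  qed
qed

text \<open>
  The thresholds one and two are the only ones that occur below: independence of colour class 1, and
  everything that concerns the diameter, can be read off the adjacency relation.
\<close>
lemma graph_dist_le_1_iff:
  assumes "wf_digraph G" "u \<in> verts G"
  shows "graph_dist G u v \<le> 1 \<longleftrightarrow> u = v \<or> u \<rightarrow>\<^bsub>G\<^esub> v"
proof -
  interpret wf_digraph G by fact
  have "(\<exists>p. awalk u p v \<and> length p \<le> 1) \<longleftrightarrow> awalk u [] v \<or> (\<exists>e. awalk u [e] v)"
    by (auto simp: le_Suc_eq length_Suc_conv)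
  also have "\<dots> \<longleftrightarrow> u = v \<or> u \<rightarrow>\<^bsub>G\<^esub> v"
    using assms by (auto simp: awalk_Nil_iff awalk_Cons_iff arcs_ends_conv)
  finally show ?thesis using graph_dist_le_iff_walk[OF assms(1), of u v 1]
    by (simp add: one_ereal_def)
qed

lemma graph_dist_le_2_iff:
  assumes "wf_digraph G" "u \<in> verts G"
  shows "graph_dist G u v \<le> 2 \<longleftrightarrow>
    u = v \<or> u \<rightarrow>\<^bsub>G\<^esub> v \<or> (\<exists>w. u \<rightarrow>\<^bsub>G\<^esub> w \<and> w \<rightarrow>\<^bsub>G\<^esub> v)"
proof -
  interpret wf_digraph G by fact
  have "(\<exists>p. awalk u p v \<and> length p \<le> 2) \<longleftrightarrow>
      awalk u [] v \<or> (\<exists>e. awalk u [e] v) \<or> (\<exists>e e'. awalk u [e, e'] v)"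
    by (auto simp: le_Suc_eq length_Suc_conv numeral_2_eq_2)
  also have "\<dots> \<longleftrightarrow> u = v \<or> u \<rightarrow>\<^bsub>G\<^esub> v \<or> (\<exists>w. u \<rightarrow>\<^bsub>G\<^esub> w \<and> w \<rightarrow>\<^bsub>G\<^esub> v)"
    using assms by (auto simp: awalk_Nil_iff awalk_Cons_iff arcs_ends_conv image_iff) metis
  finally show ?thesis using graph_dist_le_iff_walk[OF assms(1), of u v 2] by simp
qed

lemma graph_dist_le_diameter:
  assumes "fin_digraph G" "u \<in> verts G" "v \<in> verts G"
  shows "graph_dist G u v \<le> diameter G"
proof -
  interpret fin_digraph G by fact
  have "graph_dist G u v \<le> eccentricity G u"
    unfolding eccentricity_def using assms by (intro Max_ge) auto
  also have "\<dots> \<le> diameter G"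
    unfolding diameter_def using assms by (intro Max_ge) auto
  finally show ?thesis .
qed

lemma radius_le_1_if_universal_vertex:
  assumes "fin_digraph G" "v \<in> verts G"
    and univ: "\<And>w. w \<in> verts G \<Longrightarrow> w \<noteq> v \<Longrightarrow> v \<rightarrow>\<^bsub>G\<^esub> w"
  shows "radius G \<le> 1"
proof -
  interpret fin_digraph G by fact
  have "radius G \<le> eccentricity G v"
    unfolding radius_def using assms by (intro Min_le) auto
  also have "\<dots> \<le> 1"
    unfolding eccentricity_def using assms
    by (subst Max_le_iff) (auto simp: graph_dist_le_1_iff wf_digraph)
  finally show ?thesis .
qed

section \<open>Cut vertices and diameter two\<close>

lemma dominates_del_vert:
  assumes "u \<rightarrow>\<^bsub>G\<^esub> w" "u \<noteq> v" "w \<noteq> v"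
  shows "u \<rightarrow>\<^bsub>pre_digraph.del_vert G v\<^esub> w"
  using assms by (auto simp: arcs_ends_conv pre_digraph.del_vert_def)

text \<open>
  Some vertex \<open>z\<close> cannot be reached from \<open>w\<close> once \<open>v\<close> is deleted, since \<open>v\<close> separates two vertices
  and \<open>w\<close> is cut off from at least one of them. A path of length at most two from \<open>w\<close> to \<open>z\<close> must
  then have \<open>v\<close> as its middle vertex.
\<close>
lemma cut_vertex_universal_if_diameter_le_2:
  assumes "graph G" "cut_vertex G v" "diameter G \<le> 2" "w \<in> verts G" "w \<noteq> v"
  shows "v \<rightarrow>\<^bsub>G\<^esub> w"
proof -
  interpret graph G by fact
  let ?D = "del_vert v"
  interpret D: wf_digraph ?D by (rule wf_digraph_del_vert)
  have symD: "y \<rightarrow>\<^sup>*\<^bsub>?D\<^esub> x" if "x \<rightarrow>\<^sup>*\<^bsub>?D\<^esub> y" for x y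
  proof -
    have "symmetric ?D"
      using sym_arcs unfolding symmetric_conv del_vert_def by fastforce
    then show ?thesis using that by (rule symmetric_reachable)
  qed
  obtain x y where xy: "x \<in> verts G" "x \<noteq> v" "y \<in> verts G" "y \<noteq> v" "\<not> x \<rightarrow>\<^sup>*\<^bsub>?D\<^esub> y"
    using assms(2) by (auto simp: cut_vertex_def)
  obtain z where z: "z \<in> verts G" "z \<noteq> v" "\<not> w \<rightarrow>\<^sup>*\<^bsub>?D\<^esub> z"
  proof (cases "w \<rightarrow>\<^sup>*\<^bsub>?D\<^esub> x")
    case True
    then have "\<not> w \<rightarrow>\<^sup>*\<^bsub>?D\<^esub> y"
      using xy(5) D.reachable_trans[OF symD[OF True], of y] by metis
    then show ?thesis using xy that by metis
  next
    case False
    then show ?thesis using xy that by metis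
  qed
  have "graph_dist G w z \<le> 2"
    using graph_dist_le_diameter[OF fin_digraph assms(4) z(1)] assms(3) by (rule order_trans)
  moreover have "w \<noteq> z"
    using z assms(4,5) by (auto simp: verts_del_vert)
  moreover have "\<not> w \<rightarrow>\<^bsub>G\<^esub> z"
    using dominates_del_vert[of w z G v] z assms(5) by auto
  ultimately obtain u where u: "w \<rightarrow>\<^bsub>G\<^esub> u" "u \<rightarrow>\<^bsub>G\<^esub> z"
    using graph_dist_le_2_iff[OF wf_digraph assms(4)] by blast
  have "u = v"
  proof (rule ccontr)
    assume "u \<noteq> v"
    then have "w \<rightarrow>\<^bsub>?D\<^esub> u" "u \<rightarrow>\<^bsub>?D\<^esub> z"
      using u z assms(5) dominates_del_vert by metis+
    then show False
      using z(3) D.reachable_adjI D.reachable_adj_trans by blast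
  qed
  then show ?thesis
    using u(1) arcs_ends_symmetric[OF sym_arcs] by blast
qed

lemma is_block_self_if_no_cut_vertex:
  assumes "graph G" "Digraph_Component.connected G" "\<And>v. \<not> cut_vertex G v"
  shows "is_block G G"
proof -
  interpret graph G by fact
  show ?thesis
    unfolding is_block_def max_subgraph_def
  proof (intro conjI allI impI)
    show "subgraph G G" by (simp add: subgraph_def compatible_def wf_digraph)
    fix H assume "H \<noteq> G \<and> subgraph G H"
    moreover have "H = G" if "subgraph G H" "subgraph H G"
      using that by (intro pre_digraph.equality) (auto simp: subgraph_def compatible_def)
    ultimately show "\<not> (subgraph H G \<and> graph H \<and> Digraph_Component.connected H \<and> (\<forall>v. \<not> cut_vertex H v))"
      by blast
  qed (use assms in auto)
qed

section \<open>Cycles\<close>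

text \<open>
  An isomorphism onto a pair graph is turned round into an enumeration of the vertices of \<open>G\<close>, which
  determines adjacency; the individual arcs can be forgotten from here on.
\<close>
lemma digraph_iso_with_projE:
  assumes "digraph_iso G (with_proj C)" "wf_digraph G"
  obtains f where "inj_on f (pverts C)" "verts G = f ` pverts C"
    "arcs_ends G = (\<lambda>(i, j). (f i, f j)) ` parcs C"
proof -
  interpret wf_digraph G by fact
  obtain h where iso: "digraph_isomorphism h" and C: "with_proj C = app_iso h G"
    using assms(1) by (auto simp: digraph_iso_def)
  define g where "g = iso_verts h"
  define f where "f = the_inv_into (verts G) g"
  have inj: "inj_on g (verts G)"
    using iso by (simp add: g_def digraph_isomorphism_def)
  have V: "pverts C = g ` verts G" and A: "parcs C = iso_arcs h ` arcs G"
    and T: "fst = iso_tail h" and H: "snd = iso_head h"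
    using arg_cong[OF C, of verts] arg_cong[OF C, of arcs]
      arg_cong[OF C, of tail] arg_cong[OF C, of head]
    by (auto simp: g_def)
  have fg: "f (g v) = v" if "v \<in> verts G" for v
    using that inj by (simp add: f_def the_inv_into_f_f)
  have arc: "iso_arcs h a = (g (tail G a), g (head G a))" if "a \<in> arcs G" for a
    using iso that T H unfolding digraph_isomorphism_def g_def
    by (metis prod.collapse)
  show thesis
  proof
    show "inj_on f (pverts C)"
      unfolding V by (rule inj_onI) (auto simp: fg)
    show "verts G = f ` pverts C"
      unfolding V by (force simp: fg image_iff)
    show "arcs_ends G = (\<lambda>(i, j). (f i, f j)) ` parcs C"
      unfolding A arcs_ends_conv image_image
      by (intro image_cong) (auto simp: arc fg)
  qed
qed

lemma parcs_cycle_graph: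
  assumes "n > 0"
  shows "parcs (cycle_graph n) =
    (\<lambda>i. (i, (i + 1) mod n)) ` {..<n} \<union> (\<lambda>i. ((i + 1) mod n, i)) ` {..<n}"
  using assms by (auto simp: cycle_graph_def)

lemma cycle_graph_4:
  "pverts (cycle_graph 4) = {0, 1, 2, 3}"
  "parcs (cycle_graph 4) = {(0,1), (1,2), (2,3), (3,0), (1,0), (2,1), (3,2), (0,3)}"
proof -
  have four: "{..<4} = {0, 1, 2, 3::nat}" by auto
  show "pverts (cycle_graph 4) = {0, 1, 2, 3}" by (simp add: cycle_graph_def four)
  show "parcs (cycle_graph 4) = {(0,1), (1,2), (2,3), (3,0), (1,0), (2,1), (3,2), (0,3)}"
    unfolding parcs_cycle_graph[of 4, simplified] four by auto
qed

lemma cycle_graph_5: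
  "pverts (cycle_graph 5) = {0, 1, 2, 3, 4}"
  "parcs (cycle_graph 5) =
    {(0,1), (1,2), (2,3), (3,4), (4,0), (1,0), (2,1), (3,2), (4,3), (0,4)}"
proof -
  have five: "{..<5} = {0, 1, 2, 3, 4::nat}" by auto
  show "pverts (cycle_graph 5) = {0, 1, 2, 3, 4}" by (simp add: cycle_graph_def five)
  show "parcs (cycle_graph 5) =
      {(0,1), (1,2), (2,3), (3,4), (4,0), (1,0), (2,1), (3,2), (4,3), (0,4)}"
    unfolding parcs_cycle_graph[of 5, simplified] five by auto
qed

lemma cycle_length_4_or_5:
  assumes "graph G" "radius G = 2" "diameter G \<le> 2"
    and "digraph_iso G (with_proj (cycle_graph n))" "n \<ge> 3"
  shows "n = 4 \<or> n = 5"
proof -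
  interpret graph G by fact
  obtain f where inj: "inj_on f {..<n}" and V: "verts G = f ` {..<n}"
    and A: "arcs_ends G = (\<lambda>(i, j). (f i, f j)) ` parcs (cycle_graph n)"
    using digraph_iso_with_projE[OF assms(4) wf_digraph] by (auto simp: cycle_graph_def)
  have adj: "f i \<rightarrow>\<^bsub>G\<^esub> f j \<longleftrightarrow> j = (i + 1) mod n \<or> i = (j + 1) mod n" if "i < n" "j < n" for i j
  proof
    assume "f i \<rightarrow>\<^bsub>G\<^esub> f j"
    then obtain i' j' where ij: "(i', j') \<in> parcs (cycle_graph n)" "f i = f i'" "f j = f j'"
      unfolding A by auto
    then have "i = i'" "j = j'"
      using that by (auto simp: cycle_graph_def intro!: inj_onD[OF inj])
    then show "j = (i + 1) mod n \<or> i = (j + 1) mod n" using ij(1) by (simp add: cycle_graph_def)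
  next
    assume "j = (i + 1) mod n \<or> i = (j + 1) mod n"
    then have "(i, j) \<in> parcs (cycle_graph n)" using that by (simp add: cycle_graph_def)
    then show "f i \<rightarrow>\<^bsub>G\<^esub> f j" unfolding A by (rule rev_image_eqI) simp
  qed
  have "n \<noteq> 3"
  proof
    assume n: "n = 3"
    have "radius G \<le> 1"
    proof (rule radius_le_1_if_universal_vertex[OF fin_digraph])
      show "f 0 \<in> verts G" using n V by auto
      fix w assume w: "w \<in> verts G" "w \<noteq> f 0"
      then obtain i where i: "w = f i" "i < 3" unfolding V n by blast
      then have "i \<noteq> 0" using w(2) by metis
      then have "i = 1 \<or> i = 2" using i(2) by arith
      then show "f 0 \<rightarrow>\<^bsub>G\<^esub> w" using adj[of 0 i] i n by auto
    qed
    then show False using assms(2) by simp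
  qed
  moreover have "\<not> n \<ge> 6"
  proof
    assume n: "n \<ge> 6"
    have "f 0 \<in> verts G" "f 3 \<in> verts G" using V n by auto
    then have "graph_dist G (f 0) (f 3) \<le> 2"
      using graph_dist_le_diameter[OF fin_digraph] assms(3) order_trans by blast
    moreover have "f 0 \<noteq> f 3" using inj_onD[OF inj, of 0 3] n by auto
    moreover have "\<not> f 0 \<rightarrow>\<^bsub>G\<^esub> f 3" using adj[of 0 3] n by auto
    ultimately obtain u where u: "f 0 \<rightarrow>\<^bsub>G\<^esub> u" "u \<rightarrow>\<^bsub>G\<^esub> f 3"
      using graph_dist_le_2_iff[OF wf_digraph \<open>f 0 \<in> verts G\<close>] by blast
    then have "u \<in> verts G" using adj_in_verts(1) by metis
    then obtain i where i: "u = f i" "i < n" unfolding V by blast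
    have "i = 2 \<or> i = 4"
      \<comment> \<open>The neighbours of 3 are 2 and 4, while those of 0 are 1 and \<open>n - 1 \<ge> 5\<close>.\<close>
      using adj[of i 3] u(2) i n by (auto simp: mod_Suc split: if_splits)
    then show False
      using adj[of 0 i] u(1) i n by (auto simp: mod_Suc split: if_splits)
  qed
  ultimately show ?thesis using assms(5) by linarith
qed

section \<open>Packing colourings\<close>

text \<open>
  Every vertex gets its own colour. This provides the existence that the \<open>LEAST\<close> in the packing
  chromatic number relies on.
\<close>
lemma packing_colourable_card:
  assumes "finite (verts G)"
  shows "packing_colourable G (card (verts G))"
proof -
  obtain h where h: "bij_betw h {1..card (verts G)} (verts G)"
    using ex_bij_betw_nat_finite_1[OF assms] by blast
  then have im: "h ` {1..card (verts G)} = verts G" and inj: "inj_on h {1..card (verts G)}"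
    by (auto simp: bij_betw_def)
  show ?thesis
    unfolding packing_colourable_def
  proof (intro exI[of _ "\<lambda>i. {h i}"] conjI)
    show "(\<Union>i\<in>{1..card (verts G)}. {h i}) = verts G"
      by (simp only: UNION_singleton_eq_range im)
    show "disjoint_family_on (\<lambda>i. {h i}) {1..card (verts G)}"
      unfolding disjoint_family_on_def using inj_onD[OF inj] by blast
    show "\<forall>i\<in>{1..card (verts G)}. is_packing G i {h i}"
    proof
      fix i assume "i \<in> {1..card (verts G)}"
      then have "h i \<in> verts G" using im by (metis imageI)
      then show "is_packing G i {h i}" by (simp add: is_packing_def)
    qed
  qed
qed

lemma packing_colourable_chromatic_number:
  assumes "finite (verts G)" "verts G \<noteq> {}"
  shows "packing_colourable G (packing_chromatic_number G)"
proof -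
  have "card (verts G) \<ge> 1" using assms by (simp add: Suc_le_eq card_gt_0_iff)
  then have "\<exists>k. k \<ge> 1 \<and> packing_colourable G k"
    using packing_colourable_card[OF assms(1)] by blast
  from LeastI_ex[OF this] show ?thesis unfolding packing_chromatic_number_def by simp
qed

lemma packing_chromatic_number_le:
  assumes "packing_colourable G k" "k \<ge> 1"
  shows "packing_chromatic_number G \<le> k"
  unfolding packing_chromatic_number_def using assms by (intro Least_le) simp

text \<open>
  Colour 1 asks only for independence, and a class of one vertex suits any colour. Both \<open>C\<^sub>4\<close> and
  \<open>P\<^sub>5\<close> have an independent set that misses just two vertices.
\<close>
lemma packing_chromatic_number_le_3:
  assumes "wf_digraph G" "verts G \<subseteq> I \<union> {p, q}"
    and indep: "\<And>x y. x \<in> I \<Longrightarrow> y \<in> I \<Longrightarrow> \<not> x \<rightarrow>\<^bsub>G\<^esub> y"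
  shows "packing_chromatic_number G \<le> 3"
proof (rule packing_chromatic_number_le)
  \<comment> \<open>The differences keep the classes disjoint when \<open>p\<close> or \<open>q\<close> lies in \<open>I\<close> or \<open>p = q\<close>.\<close>
  let ?X = "\<lambda>i::nat. (if i = 1 then I - {p, q} else if i = 2 then {p} else {q} - {p}) \<inter> verts G"
  have three: "{1..3} = {1, 2, 3::nat}" by auto
  have "graph_dist G x y > 1" if "x \<in> ?X 1" "y \<in> ?X 1" "x \<noteq> y" for x y
    using that indep graph_dist_le_1_iff[OF assms(1), of x y] by (auto simp: not_le)
  then show "packing_colourable G 3"
    unfolding packing_colourable_def three
    using assms(2)
    by (intro exI[of _ ?X])
       (auto simp: disjoint_family_on_def is_packing_def one_ereal_def)
qed simp

text \<open>
  With colours 1 and 2 only, each of the three edges has an end of colour 2, as colour 1 is independent.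
  If \<open>b\<close> has colour 2, neither \<open>c\<close> nor \<open>d\<close> does; if not, both \<open>a\<close> and \<open>c\<close> do, at distance at
  most two. Chords of the path could only shorten distances, so it may be any subgraph of \<open>G\<close>.
\<close>
lemma packing_colourable_path_4:
  assumes "wf_digraph G" "packing_colourable G k"
    and "distinct [a, b, c, d]" "a \<rightarrow>\<^bsub>G\<^esub> b" "b \<rightarrow>\<^bsub>G\<^esub> c" "c \<rightarrow>\<^bsub>G\<^esub> d"
  shows "3 \<le> k"
proof (rule ccontr)
  assume "\<not> 3 \<le> k"
  then have k: "i = 1 \<or> i = 2" if "i \<in> {1..k}" for i using that by auto
  interpret wf_digraph G by fact
  obtain X where X: "(\<Union>i\<in>{1..k}. X i) = verts G" "\<And>i. i \<in> {1..k} \<Longrightarrow> is_packing G i (X i)"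
    using assms(2) by (auto simp: packing_colourable_def)
  have V: "a \<in> verts G" "b \<in> verts G" "c \<in> verts G" "d \<in> verts G"
    using assms(4-6) adj_in_verts by blast+
  define P where "P i v \<longleftrightarrow> i \<in> {1..k} \<and> v \<in> X i" for i v
  have cover: "P 1 v \<or> P 2 v" if "v \<in> verts G" for v
    using that X(1) k unfolding P_def by blast
  have one: "\<not> (P 1 x \<and> P 1 y)" if "x \<rightarrow>\<^bsub>G\<^esub> y" "x \<noteq> y" for x y
  proof
    assume "P 1 x \<and> P 1 y"
    then have "graph_dist G x y > 1"
      using X(2)[of 1] that unfolding P_def is_packing_def by (auto simp: one_ereal_def)
    then show False
      using graph_dist_le_1_iff[OF assms(1), of x y] that adj_in_verts by auto
  qed
  have two: "\<not> (P 2 x \<and> P 2 y)"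
    if "x \<rightarrow>\<^bsub>G\<^esub> y \<or> (\<exists>z. x \<rightarrow>\<^bsub>G\<^esub> z \<and> z \<rightarrow>\<^bsub>G\<^esub> y)" "x \<noteq> y" for x y
  proof
    assume "P 2 x \<and> P 2 y"
    then have "graph_dist G x y > 2"
      using X(2)[of 2] that unfolding P_def is_packing_def by auto
    moreover have "x \<in> verts G" using that adj_in_verts by blast
    ultimately show False
      using graph_dist_le_2_iff[OF assms(1), of x y] that by auto
  qed
  show False
    using cover[OF V(1)] cover[OF V(2)] cover[OF V(3)] cover[OF V(4)]
      one[OF assms(4)] one[OF assms(5)] one[OF assms(6)]
      two[of a c] two[of b c] two[of b d] assms(3-6) by auto
qed

text \<open>
  A counting bound with \<open>m + 1\<close> as a bound on the independence number: colour 1 takes at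
  most \<open>m + 1\<close> vertices, and any other colour at most one, because distances never exceed two.
\<close>
lemma card_le_if_packing_colourable_diameter_le_2:
  assumes "fin_digraph G" "diameter G \<le> 2" "packing_colourable G k"
    and indep: "\<And>I. I \<subseteq> verts G \<Longrightarrow> (\<And>x y. x \<in> I \<Longrightarrow> y \<in> I \<Longrightarrow> \<not> x \<rightarrow>\<^bsub>G\<^esub> y) \<Longrightarrow> card I \<le> Suc m"
    and loopfree: "\<And>x. \<not> x \<rightarrow>\<^bsub>G\<^esub> x"
  shows "card (verts G) \<le> k + m"
proof -
  interpret fin_digraph G by fact
  obtain X where X: "(\<Union>i\<in>{1..k}. X i) = verts G" "\<And>i. i \<in> {1..k} \<Longrightarrow> is_packing G i (X i)"
    using assms(3) by (auto simp: packing_colourable_def)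
  have sub: "X i \<subseteq> verts G" if "i \<in> {1..k}" for i using X(1) that by blast
  have c1: "card (X i) \<le> Suc m" if "i \<in> {1..k}" "i = 1" for i
  proof (rule indep[OF sub[OF that(1)]])
    fix x y assume xy: "x \<in> X i" "y \<in> X i"
    show "\<not> x \<rightarrow>\<^bsub>G\<^esub> y"
    proof
      assume "x \<rightarrow>\<^bsub>G\<^esub> y"
      moreover have "x \<noteq> y" using loopfree calculation by auto
      moreover have "graph_dist G x y > 1"
        using X(2)[OF that(1)] xy that(2) \<open>x \<noteq> y\<close>
        by (auto simp: is_packing_def one_ereal_def)
      ultimately show False
        using graph_dist_le_1_iff[OF wf_digraph, of x y] adj_in_verts by auto
    qed
  qed
  have c2: "card (X i) \<le> 1" if "i \<in> {1..k}" "i \<noteq> 1" for i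
  proof -
    have "x = y" if xy: "x \<in> X i" "y \<in> X i" for x y
    proof (rule ccontr)
      assume "x \<noteq> y"
      then have "ereal (real i) < graph_dist G x y"
        using X(2)[OF \<open>i \<in> {1..k}\<close>] xy by (auto simp: is_packing_def)
      also have "\<dots> \<le> diameter G"
        using xy sub[OF \<open>i \<in> {1..k}\<close>] by (intro graph_dist_le_diameter fin_digraph) auto
      also have "\<dots> \<le> ereal (real 2)" using assms(2) by simp
      finally show False using that \<open>i \<in> {1..k}\<close> \<open>i \<noteq> 1\<close> by simp
    qed
    moreover have "finite (X i)" using sub[OF that(1)] by (rule finite_subset) simp
    ultimately show ?thesis by (simp add: card_le_Suc0_iff_eq)
  qed
  have "card (verts G) \<le> (\<Sum>i\<in>{1..k}. card (X i))"
    unfolding X(1)[symmetric] by (rule card_UN_le) simp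
  also have "\<dots> \<le> (\<Sum>i\<in>{1..k}. 1 + (if i = 1 then m else 0))"
    using c1 c2 by (intro sum_mono) force
  also have "\<dots> \<le> k + m"
    by (subst sum.distrib) (simp add: sum.delta)
  finally show ?thesis .
qed

section \<open>Subgraphs\<close>

text \<open>
  Without parallel arcs an arc is determined by its ends, so a proper subgraph is recognised by
  a missing vertex or a missing adjacency.
\<close>
lemma subgraph_eq_if_arcs_ends_subset:
  assumes "digraph G" "subgraph H G" "verts G \<subseteq> verts H" "arcs_ends G \<subseteq> arcs_ends H"
  shows "H = G"
proof -
  interpret digraph G by fact
  have s: "verts H \<subseteq> verts G" "arcs H \<subseteq> arcs G" "tail H = tail G" "head H = head G"
    using assms(2) by (auto simp: subgraph_def compatible_def)
  have "e \<in> arcs H" if e: "e \<in> arcs G" for e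
  proof -
    have "arc_to_ends G e \<in> arcs_ends H" using e assms(4) by (auto simp: arcs_ends_def)
    then obtain e' where "e' \<in> arcs H" "arc_to_ends G e = arc_to_ends G e'"
      using s by (auto simp: arcs_ends_def arc_to_ends_def)
    then show ?thesis using no_multi_arcs e s by blast
  qed
  then show ?thesis using s assms(3) by (intro pre_digraph.equality) auto
qed

definition del_edge :: "('a, 'b) pre_digraph \<Rightarrow> 'a \<Rightarrow> 'a \<Rightarrow> ('a, 'b) pre_digraph" where
  "del_edge G u v = G\<lparr>arcs := {e \<in> arcs G. {tail G e, head G e} \<noteq> {u, v}}\<rparr>"

lemma arcs_ends_del_edge: "arcs_ends (del_edge G u v) = arcs_ends G - {(u, v), (v, u)}"
  by (auto simp: arcs_ends_conv del_edge_def doubleton_eq_iff)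

lemma subgraph_del_edge:
  assumes "wf_digraph G"
  shows "subgraph (del_edge G u v) G"
proof -
  interpret wf_digraph G by fact
  have "wf_digraph (del_edge G u v)" by unfold_locales (auto simp: del_edge_def)
  then show ?thesis by (auto simp: subgraph_def compatible_def wf_digraph del_edge_def)
qed

lemma graph_del_edge:
  assumes "graph G"
  shows "graph (del_edge G u v)"
proof -
  interpret graph G by fact
  interpret D: digraph "del_edge G u v"
    by (rule digraph_subgraph[OF subgraph_del_edge[OF wf_digraph]])
  have "symmetric (del_edge G u v)"
    using sym_arcs by (auto simp: symmetric_def arcs_ends_del_edge sym_def)
  then show ?thesis by (rule D.graphI)
qed

section \<open>The two cycles of diameter two\<close>

lemma cycle_4_not_critical:
  assumes "graph G" "digraph_iso G (with_proj (cycle_graph 4))"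
  shows "\<not> packing_critical G"
proof
  assume crit: "packing_critical G"
  interpret graph G by fact
  obtain f where inj: "inj_on f {0, 1, 2, 3::nat}" and V: "verts G = f ` {0, 1, 2, 3}"
    and A: "arcs_ends G = (\<lambda>(i, j). (f i, f j)) ` parcs (cycle_graph 4)"
    using digraph_iso_with_projE[OF assms(2) wf_digraph] unfolding cycle_graph_4(1) by metis
  have dist: "distinct [f 0, f 1, f 2, f 3]" using inj by (auto simp: inj_on_def)
  let ?H = "del_edge G (f 3) (f 0)"
  have H: "graph ?H" "subgraph ?H G"
    using assms(1) wf_digraph by (auto intro: graph_del_edge subgraph_del_edge)
  interpret H: graph ?H by fact
  have "f 3 \<rightarrow>\<^bsub>G\<^esub> f 0" unfolding A cycle_graph_4 by auto
  moreover have "\<not> f 3 \<rightarrow>\<^bsub>?H\<^esub> f 0" by (simp add: arcs_ends_del_edge)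
  ultimately have "?H \<noteq> G" by metis
  then have lt: "packing_chromatic_number ?H < packing_chromatic_number G"
    using crit H unfolding packing_critical_def by blast
  have "packing_chromatic_number G \<le> 3"
    using dist unfolding V
    by (intro packing_chromatic_number_le_3[where I = "{f 0, f 2}" and p = "f 1" and q = "f 3"]
        wf_digraph) (auto simp: V A cycle_graph_4)
  moreover have "3 \<le> packing_chromatic_number ?H"
  proof (rule packing_colourable_path_4[OF H.wf_digraph _ dist])
    show "packing_colourable ?H (packing_chromatic_number ?H)"
      by (rule packing_colourable_chromatic_number) (auto simp: del_edge_def V)
  qed (use dist in \<open>auto simp: arcs_ends_del_edge A cycle_graph_4\<close>)
  ultimately show False using lt by simp
qed

lemma cycle_5_critical:
  assumes "graph G" "digraph_iso G (with_proj (cycle_graph 5))" "diameter G \<le> 2"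
  shows "packing_critical G"
  unfolding packing_critical_def
proof (intro allI impI, elim conjE)
  fix H assume H: "graph H" "subgraph H G" "H \<noteq> G"
  interpret graph G by fact
  interpret H: graph H by fact
  obtain f where inj: "inj_on f {0, 1, 2, 3, 4::nat}" and V: "verts G = f ` {0, 1, 2, 3, 4}"
    and A: "arcs_ends G = (\<lambda>(i, j). (f i, f j)) ` parcs (cycle_graph 5)"
    using digraph_iso_with_projE[OF assms(2) wf_digraph] unfolding cycle_graph_5(1) by metis
  define a b c d e where abcde: "a = f 0" "b = f 1" "c = f 2" "d = f 3" "e = f 4"
  have dist: "distinct [a, b, c, d, e]" using inj by (auto simp: inj_on_def abcde)
  have V: "verts G = {a, b, c, d, e}" unfolding V abcde by simp
  have A: "arcs_ends G =
      {(a,b), (b,c), (c,d), (d,e), (e,a), (b,a), (c,b), (d,c), (e,d), (a,e)}"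
    unfolding A cycle_graph_5 abcde by simp

  \<comment> \<open>The summand 1 is the independence number of \<open>C\<^sub>5\<close> minus one.\<close>
  have "card (verts G) \<le> packing_chromatic_number G + 1"
  proof (rule card_le_if_packing_colourable_diameter_le_2[OF fin_digraph assms(3)])
    show "packing_colourable G (packing_chromatic_number G)"
      by (rule packing_colourable_chromatic_number) (auto simp: V)
    show "\<not> x \<rightarrow>\<^bsub>G\<^esub> x" for x using adj_not_same by blast
    fix I assume I: "I \<subseteq> verts G" "\<And>x y. x \<in> I \<Longrightarrow> y \<in> I \<Longrightarrow> \<not> x \<rightarrow>\<^bsub>G\<^esub> y"
    have "\<not> (a \<in> I \<and> b \<in> I)" "\<not> (b \<in> I \<and> c \<in> I)" "\<not> (c \<in> I \<and> d \<in> I)"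
      "\<not> (d \<in> I \<and> e \<in> I)" "\<not> (e \<in> I \<and> a \<in> I)"
      using I(2) unfolding A by blast+
    then have "I \<subseteq> {a, c} \<or> I \<subseteq> {a, d} \<or> I \<subseteq> {b, d} \<or> I \<subseteq> {b, e} \<or> I \<subseteq> {c, e}"
      using I(1) unfolding V by blast
    then have "\<exists>x y. I \<subseteq> {x, y}" by blast
    then obtain x y where "I \<subseteq> {x, y}" by blast
    then have "card I \<le> card {x, y}" by (intro card_mono) auto
    also have "\<dots> \<le> Suc 1" using card_insert_le_m1[of 2 "{y}" x] by simp
    finally show "card I \<le> Suc 1" .
  qed
  moreover have "card (verts G) = 5" unfolding V using dist by simp
  ultimately have lower: "4 \<le> packing_chromatic_number G" by simp

  have sub: "verts H \<subseteq> {a, b, c, d, e}" "arcs_ends H \<subseteq> arcs_ends G"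
    using H(2) arcs_ends_mono[OF H(2)] unfolding V[symmetric] by (simp_all add: subgraph_def)
  have symH: "y \<rightarrow>\<^bsub>H\<^esub> x" if "x \<rightarrow>\<^bsub>H\<^esub> y" for x y
    using that by (rule arcs_ends_symmetric[OF H.sym_arcs])
  \<comment> \<open>If the edge \<open>vu\<close> is missing, \<open>H\<close> lies in the path \<open>u, p, w, q, v\<close>.\<close>
  have path: "packing_chromatic_number H \<le> 3"
    if "\<not> v \<rightarrow>\<^bsub>H\<^esub> u" "verts H \<subseteq> {u, w, v, p, q}" "u \<noteq> v" "\<not> u \<rightarrow>\<^bsub>G\<^esub> w" "\<not> w \<rightarrow>\<^bsub>G\<^esub> v" for u w v p q
  proof (rule packing_chromatic_number_le_3[OF H.wf_digraph])
    show "verts H \<subseteq> {u, w, v} \<union> {p, q}" using that by auto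
    fix x y assume "x \<in> {u, w, v}" "y \<in> {u, w, v}"
    then show "\<not> x \<rightarrow>\<^bsub>H\<^esub> y" using that sub(2) symH H.adj_not_same by blast
  qed
  have "\<not> (a \<rightarrow>\<^bsub>H\<^esub> b \<and> b \<rightarrow>\<^bsub>H\<^esub> c \<and> c \<rightarrow>\<^bsub>H\<^esub> d \<and> d \<rightarrow>\<^bsub>H\<^esub> e \<and> e \<rightarrow>\<^bsub>H\<^esub> a)"
  proof
    assume *: "a \<rightarrow>\<^bsub>H\<^esub> b \<and> b \<rightarrow>\<^bsub>H\<^esub> c \<and> c \<rightarrow>\<^bsub>H\<^esub> d \<and> d \<rightarrow>\<^bsub>H\<^esub> e \<and> e \<rightarrow>\<^bsub>H\<^esub> a"
    then have "verts G \<subseteq> verts H" using H.adj_in_verts unfolding V by blast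
    moreover have "arcs_ends G \<subseteq> arcs_ends H" using * symH unfolding A by blast
    ultimately show False
      using subgraph_eq_if_arcs_ends_subset[OF _ H(2)] H(3) digraph_axioms by blast
  qed
  then consider "\<not> a \<rightarrow>\<^bsub>H\<^esub> b" | "\<not> b \<rightarrow>\<^bsub>H\<^esub> c" | "\<not> c \<rightarrow>\<^bsub>H\<^esub> d" | "\<not> d \<rightarrow>\<^bsub>H\<^esub> e" | "\<not> e \<rightarrow>\<^bsub>H\<^esub> a"
    by blast
  then have "packing_chromatic_number H \<le> 3"
  proof cases
    case 1 show ?thesis using dist sub(1) by (intro path[OF 1, of d c e]) (auto simp: A)
  next
    case 2 show ?thesis using dist sub(1) by (intro path[OF 2, of e d a]) (auto simp: A)
  next
    case 3 show ?thesis using dist sub(1) by (intro path[OF 3, of a e b]) (auto simp: A)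
  next
    case 4 show ?thesis using dist sub(1) by (intro path[OF 4, of b a c]) (auto simp: A)
  next
    case 5 show ?thesis using dist sub(1) by (intro path[OF 5, of c b d]) (auto simp: A)
  qed
  then show "packing_chromatic_number H < packing_chromatic_number G" using lower by simp
qed

lemma cactus_radius_2_diameter_2_cycle:
  assumes "cactus_graph G" "radius G = 2" "diameter G \<le> 2"
  shows "digraph_iso G (with_proj (cycle_graph 4)) \<or> digraph_iso G (with_proj (cycle_graph 5))"
proof -
  have G: "graph G" "Digraph_Component.connected G"
    using assms(1) by (auto simp: cactus_graph_def)
  interpret graph G by fact
  have no_universal: False
    if "v \<in> verts G" "\<And>w. w \<in> verts G \<Longrightarrow> w \<noteq> v \<Longrightarrow> v \<rightarrow>\<^bsub>G\<^esub> w" for v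
    using radius_le_1_if_universal_vertex[OF fin_digraph that] assms(2) by simp
  have "\<not> cut_vertex G v" for v
    using no_universal[of v] cut_vertex_universal_if_diameter_le_2[OF G(1) _ assms(3)]
    by (auto simp: cut_vertex_def)
  then have "is_block G G" by (intro is_block_self_if_no_cut_vertex G)
  then consider n where "n \<ge> 3" "digraph_iso G (with_proj (cycle_graph n))"
    | "complete_digraph 2 G"
    using assms(1) by (auto simp: cactus_graph_def)
  then show ?thesis
  proof cases
    case 1
    then show ?thesis using cycle_length_4_or_5[OF G(1) assms(2,3)] by blast
  next
    case 2
    then have "verts G \<noteq> {}" "arcs_ends G = {(u, v). (u, v) \<in> verts G \<times> verts G \<and> u \<noteq> v}"
      by (auto simp: complete_digraph_def)
    then show ?thesis using no_universal by blast
  qed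
qed

theorem theorem4p5:
  fixes G :: "('a, 'b) pre_digraph"
  assumes "cactus_graph G"
    and "radius G = 2"
    and "diameter G = 2"
  shows "packing_critical G \<longleftrightarrow> digraph_iso G (with_proj (cycle_graph 5))"
proof -
  have "graph G" using assms(1) by (simp add: cactus_graph_def)
  moreover have "diameter G \<le> 2" using assms(3) by simp
  ultimately show ?thesis
    using cactus_radius_2_diameter_2_cycle[OF assms(1,2)] cycle_4_not_critical cycle_5_critical
    by metis
qed

end
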